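(* Consider the meteor process on the circular graph $C_k$ in the stationary regime; that is, assume that the distribution of $\mathcal{M}_0=(M^1_0,\dots,M^k_0)$ is the stationary measure $Q$ with total mass $k$. Let $F^k_0=\{M^2_0=0\}$. For $n\ge1$ and $k\ge n+4$, let $F^k_n$ be the event that $M^i_0>0$ for $i=3,4,\dots,n+2$ and $M^2_0=M^{n+3}_0=0$. For $n\ge1$ and $k\ge n+3$, let $\widehat F^k_n$ be the event that $M^i_0>0$ for $i=3,\dots,n+2$. Then $$p_0:=\mathbb{P}(F^k_0)=\frac13,\qquad k\ge3,$$ $$p_n:=\mathbb{P}(F^k_n)=\frac{n(n+3)2^{n+1}}{(n+4)!},\qquad n\ge1,\ k\ge n+4,$$ $$\widehat p_n:=\mathbb{P}(\widehat F^k_n)=\frac{2^{n+1}}{(n+2)!},\qquad n\ge1,\ k\ge n+3.$$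
   Context: $C_k$ is the circular graph with vertices $1,\dots,k$ and edges $(j,j+1)$, $1\le j\le k-1$, and $(k,1)$. Meteor process on $C_k$ ($k\ge3$): let $N^j$, $1\le j\le k$, be jointly independent rate 1 Poisson processes, independent of the nonnegative initial vector $\mathcal{M}_0$. At a jump time $t$ of $N^j$, $M^j_t=0$ and each of the two neighbors $x$ of $j$ receives half of the mass: $M^x_t=M^x_{t-}+M^j_{t-}/2$; all other masses are unchanged, and masses are constant between jumps. When $\sum_jM^j_0=k$, this Markov process has a unique stationary distribution, denoted $Q$. *)

theory Defs
  imports "HOL-Probability.Probability"
begin

definition left_lim :: "(real \<Rightarrow> 'a::t2_space) \<Rightarrow> real \<Rightarrow> 'a" where
  "left_lim f t = Lim (at_left t) f"

text \<open>
  Processes are functions of a real time parameter; only times \<open>t \<ge> 0\<close> matter.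
  The subtraction of natural numbers in the increments truncates only on a null set, since the
  paths are almost surely nondecreasing. Continuity is with respect to the discrete topology
  on \<open>nat\<close>.
\<close>

locale poisson_process = prob_space P for P :: "'w measure" +
  fixes r :: real and N :: "real \<Rightarrow> 'w \<Rightarrow> nat"
  assumes measurable_N: "\<And>t. 0 \<le> t \<Longrightarrow> random_variable (count_space UNIV) (N t)"
    and counting_path: "AE \<omega> in P. N 0 \<omega> = 0 \<and> mono_on {0..} (\<lambda>t. N t \<omega>) \<and>
      (\<forall>t\<ge>0. continuous (at_right t) (\<lambda>s. N s \<omega>))"
    and indep_increments: "\<And>t n. 0 \<le> t 0 \<Longrightarrow> strict_mono t \<Longrightarrow>
      indep_vars (\<lambda>_. count_space UNIV) (\<lambda>i \<omega>. N (t (Suc i)) \<omega> - N (t i) \<omega>) {..<n::nat}"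
    and poisson_increments: "\<And>s t. 0 \<le> s \<Longrightarrow> s < t \<Longrightarrow>
      distr P (count_space UNIV) (\<lambda>\<omega>. N t \<omega> - N s \<omega>) = measure_pmf (poisson_pmf (r * (t - s)))"

definition circular_edges :: "nat \<Rightarrow> nat set set" where
  "circular_edges k = {{j, j + 1} | j. 1 \<le> j \<and> j \<le> k - 1} \<union> {{k, 1}}"

definition state_space :: "nat \<Rightarrow> (nat \<Rightarrow> real) measure" where
  "state_space k = (\<Pi>\<^sub>M j\<in>{1..k}. borel)"

definition meteor_hit :: "nat \<Rightarrow> nat \<Rightarrow> (nat \<Rightarrow> real) \<Rightarrow> (nat \<Rightarrow> real)" where
  "meteor_hit k j m = (\<lambda>x\<in>{1..k}.
     if x = j then 0
     else if {j, x} \<in> circular_edges k then m x + m j / 2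
     else m x)"

text \<open>
  \<open>M t \<omega> x\<close> is the mass at the vertex \<open>x\<close> at time \<open>t\<close>. The dynamics are required
  almost surely, because two of the Poisson processes may jump simultaneously on a null set. The
  \<open>\<sigma>\<close>-algebras in \<open>indep_initial\<close> are those generated by \<open>M 0\<close> and by the whole family
  \<open>(N j t)\<close> with \<open>j \<in> {1..k}\<close> and \<open>t \<ge> 0\<close>.
\<close>

locale meteor_process = prob_space P for P :: "'w measure" +
  fixes k :: nat and N :: "nat \<Rightarrow> real \<Rightarrow> 'w \<Rightarrow> nat" and M :: "real \<Rightarrow> 'w \<Rightarrow> nat \<Rightarrow> real"
  assumes k_ge_3: "k \<ge> 3"
    and poisson: "\<And>j. j \<in> {1..k} \<Longrightarrow> poisson_process P 1 (N j)"
    and indep_poisson: "indep_vars (\<lambda>_. \<Pi>\<^sub>M t\<in>{0..}. count_space UNIV)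
      (\<lambda>j \<omega>. \<lambda>t\<in>{0..}. N j t \<omega>) {1..k}"
    and measurable_M: "\<And>t. 0 \<le> t \<Longrightarrow> random_variable (state_space k) (M t)"
    and initial_nonneg: "AE \<omega> in P. \<forall>j\<in>{1..k}. M 0 \<omega> j \<ge> 0"
    and indep_initial: "indep_set
      (sets (vimage_algebra (space P) (M 0) (state_space k)))
      (sets (vimage_algebra (space P) (\<lambda>\<omega>. \<lambda>(j, t)\<in>{1..k} \<times> {0..}. N j t \<omega>)
        (\<Pi>\<^sub>M jt\<in>{1..k} \<times> {0..}. count_space UNIV)))"
    and jumps: "AE \<omega> in P. \<forall>j\<in>{1..k}. \<forall>t>0.
      N j t \<omega> \<noteq> left_lim (\<lambda>s. N j s \<omega>) t \<longrightarrow>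
      M t \<omega> = meteor_hit k j (\<lambda>x. left_lim (\<lambda>s. M s \<omega> x) t)"
    and constant_between_jumps: "AE \<omega> in P. \<forall>s t. 0 \<le> s \<and> s \<le> t \<and>
      (\<forall>j\<in>{1..k}. N j s \<omega> = N j t \<omega>) \<longrightarrow> M t \<omega> = M s \<omega>"

text \<open>
  The process started from a law \<open>Q\<close>, carried by configurations of total mass \<open>k\<close>, that is
  invariant under the dynamics.
\<close>

locale stationary_meteor_process = meteor_process P k N M
  for P :: "'w measure" and k N M +
  fixes Q :: "(nat \<Rightarrow> real) measure"
  assumes initial_law: "distr P (state_space k) (M 0) = Q"
    and total_mass: "AE m in Q. (\<Sum>j=1..k. m j) = real k"
    and invariant_law: "\<And>t. 0 \<le> t \<Longrightarrow> distr P (state_space k) (M t) = Q"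

end

theory Submission imports Defs begin

text \<open>
  The law of the set of empty sites is determined by a single identity. For a measurable set
  \<open>R\<close> of configurations, let \<open>p\<close> be its stationary probability and let \<open>q j\<close> be the
  probability that the stationary configuration lies in \<open>R\<close> after a hit at \<open>j\<close>. Since every
  site is hit at rate 1, stationarity means \<open>q 1 + ... + q k = k p\<close> (lemma \<open>balance\<close>). It is
  derived by comparing times \<open>0\<close> and \<open>t\<close>: the number of hits in \<open>[0, t]\<close> is independent of the
  initial configuration, it is 0 or 1 up to a probability of order \<open>t\<^sup>2\<close>, and the path
  properties determine the configuration at time \<open>t\<close> in these two cases.

  A hit empties a site, and both neighbours are positive afterwards unless the hit site
  and that neighbour were both empty. Hence adjacent empty sites are never created. The balance
  identity turns this into the statement that an interval of at least two empty sites can be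
  enlarged by a neighbouring site without changing its probability, so that probability equals
  the probability that all sites are empty, which is 0 because the total mass is \<open>k\<close> (lemma
  \<open>prob_zero_interval\<close>). So almost surely a hit makes the site empty and its neighbours positive,
  whatever the masses were.

  Let \<open>a n\<close> be the probability that \<open>n\<close> given consecutive sites are positive. Of the \<open>n + 2\<close>
  sites that affect this event, a hit at one of the \<open>n\<close> inner ones destroys it, while a hit at one
  of the two outer ones leaves a condition on \<open>n - 1\<close> consecutive sites. Balance reads
  \<open>(n + 2) a n = 2 a (n - 1)\<close>, so \<open>a n = 2 ^ (n + 1) / (n + 2)!\<close>. In particular a site is empty
  with probability \<open>1 - a 1 = 1 / 3\<close>. In the same way, let \<open>b n\<close> be the probability of \<open>n\<close>
  consecutive positive sites between two empty ones. Here \<open>n + 4\<close> sites matter, and only hits at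
  the two sites that are to be empty do not destroy the event; they leave \<open>n - 1\<close> positive sites
  followed by an empty one, an event of probability \<open>a (n - 1) - a n\<close>. Hence
  \<open>(n + 4) b n = 2 (a (n - 1) - a n)\<close>, which is the stated value.
\<close>

section \<open>The effect of a hit\<close>

lemma circular_edges_iff:
  assumes "k \<ge> 3" "j \<in> {1..k}" "x \<in> {1..k}"
  shows "{j, x} \<in> circular_edges k \<longleftrightarrow>
    x = j + 1 \<or> j = x + 1 \<or> (j = 1 \<and> x = k) \<or> (j = k \<and> x = 1)"
  using assms by (auto simp: circular_edges_def doubleton_eq_iff)

lemma meteor_hit_self: "x \<in> {1..k} \<Longrightarrow> meteor_hit k x m x = 0"
  by (simp add: meteor_hit_def)

lemma meteor_hit_neighbour:
  assumes "k \<ge> 3" "j \<in> {1..k}" "x \<in> {1..k}" "{j, x} \<in> circular_edges k"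
  shows "meteor_hit k j m x = m x + m j / 2"
  using assms by (auto simp: meteor_hit_def circular_edges_iff)

lemma meteor_hit_apply:
  assumes "k \<ge> 3" "j \<in> {1..k}" "x \<in> {1..k}"
  shows "meteor_hit k j m x = (if x = j then 0
    else if x = j + 1 \<or> j = x + 1 \<or> (j = 1 \<and> x = k) \<or> (j = k \<and> x = 1) then m x + m j / 2
    else m x)"
  using assms by (simp add: meteor_hit_def circular_edges_iff[OF assms])

lemma measurable_mass [measurable]:
  "x \<in> {1..k} \<Longrightarrow> (\<lambda>m. m x) \<in> borel_measurable (state_space k)"
  unfolding state_space_def by measurable

lemma measurable_meteor_hit [measurable]:
  assumes "j \<in> {1..k}"
  shows "meteor_hit k j \<in> state_space k \<rightarrow>\<^sub>M state_space k"
  unfolding meteor_hit_def by (subst (2) state_space_def) (use assms in measurable)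

section \<open>Paths with at most one hit\<close>

text \<open>
  The jump time is the infimum of the times at which the value is 1; right continuity in the
  discrete topology makes the infimum itself such a time.
\<close>

lemma first_jump:
  fixes f :: "real \<Rightarrow> nat"
  assumes mono: "mono_on {0..} f"
    and rcont: "\<forall>t\<ge>0. continuous (at_right t) f"
    and "f 0 = 0" "f t = 1" "0 \<le> t"
  obtains s where "0 < s" "s \<le> t" "f s = 1" "\<And>u. 0 \<le> u \<Longrightarrow> u < s \<Longrightarrow> f u = 0"
proof -
  define S where "S = {u. 0 \<le> u \<and> u \<le> t \<and> f u = 1}"
  define s where "s = Inf S"
  have bdd: "bdd_below S" unfolding S_def by (rule bdd_belowI[of _ 0]) auto
  have "t \<in> S" using assms by (auto simp: S_def)
  then have "s \<le> t" unfolding s_def by (rule cInf_lower) (rule bdd)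
  have "0 \<le> s" unfolding s_def using \<open>t \<in> S\<close> by (intro cInf_greatest) (auto simp: S_def)
  have le1: "f u \<le> 1" if "0 \<le> u" "u \<le> t" for u
    using mono_onD[OF mono, of u t] that \<open>f t = 1\<close> by auto
  have before: "f u = 0" if "0 \<le> u" "u < s" for u
  proof (rule ccontr)
    assume "f u \<noteq> 0"
    with le1[of u] that \<open>s \<le> t\<close> have "u \<in> S" by (auto simp: S_def)
    then have "s \<le> u" unfolding s_def by (rule cInf_lower) (rule bdd)
    with that show False by simp
  qed
  have "f s \<noteq> 0"
  proof
    assume "f s = 0"
    have "(f \<longlongrightarrow> f s) (at_right s)"
      using rcont \<open>0 \<le> s\<close> by (simp add: continuous_within)
    then have "eventually (\<lambda>u. f u = f s) (at_right s)" by (simp add: tendsto_discrete)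
    then obtain b where b: "b > s" "\<And>u. s < u \<Longrightarrow> u < b \<Longrightarrow> f u = 0"
      using \<open>f s = 0\<close> by (auto simp: eventually_at_right_field)
    then obtain u where u: "u \<in> S" "u < b"
      using cInf_lessD[of S b] \<open>t \<in> S\<close> by (auto simp: s_def)
    moreover have "s \<le> u" unfolding s_def using u(1) bdd by (rule cInf_lower)
    ultimately show False using b(2)[of u] \<open>f s = 0\<close> by (cases "u = s") (auto simp: S_def)
  qed
  with le1[of s] \<open>0 \<le> s\<close> \<open>s \<le> t\<close> have "f s = 1" by auto
  moreover have "0 < s" using \<open>f s \<noteq> 0\<close> \<open>f 0 = 0\<close> \<open>0 \<le> s\<close> by (cases "s = 0") auto
  ultimately show thesis using that before \<open>s \<le> t\<close> by blast
qed

lemma left_lim_eqI: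
  assumes "\<And>u. a \<le> u \<Longrightarrow> u < s \<Longrightarrow> f u = c" "a < s"
  shows "left_lim f s = c"
proof -
  have "eventually (\<lambda>u. f u = c) (at_left s)"
    using eventually_at_left_real[OF \<open>a < s\<close>] by eventually_elim (use assms in auto)
  then have "(f \<longlongrightarrow> c) (at_left s)" by (rule tendsto_eventually)
  then show ?thesis unfolding left_lim_def by (intro tendsto_Lim) auto
qed

context meteor_process
begin

lemma AE_counting_paths:
  "AE \<omega> in P. \<forall>j\<in>{1..k}. N j 0 \<omega> = 0 \<and> mono_on {0..} (\<lambda>t. N j t \<omega>) \<and>
      (\<forall>t\<ge>0. continuous (at_right t) (\<lambda>s. N j s \<omega>))"
  using poisson_process.counting_path[OF poisson] by (intro AE_finite_allI) auto

lemma AE_no_jump: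
  assumes "0 \<le> t"
  shows "AE \<omega> in P. (\<forall>i\<in>{1..k}. N i t \<omega> = 0) \<longrightarrow> M t \<omega> = M 0 \<omega>"
  using AE_counting_paths constant_between_jumps
  by eventually_elim (use assms in auto)

text \<open>
  All configurations before the hit coincide with the initial one, so the left limits in
  the jump rule are the initial masses; after the hit all counts stay constant.
\<close>

lemma AE_one_jump:
  assumes "0 \<le> t" "j \<in> {1..k}"
  shows "AE \<omega> in P. (\<forall>i\<in>{1..k}. N i t \<omega> = of_bool (i = j)) \<longrightarrow>
    M t \<omega> = meteor_hit k j (M 0 \<omega>)"
  using AE_counting_paths constant_between_jumps jumps
proof eventually_elim
  case (elim \<omega>)
  show ?case
  proof
    assume one: "\<forall>i\<in>{1..k}. N i t \<omega> = of_bool (i = j)"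
    have "N j t \<omega> = 1" using one \<open>j \<in> {1..k}\<close> by simp
    then obtain s where s: "0 < s" "s \<le> t" "N j s \<omega> = 1" "\<And>u. 0 \<le> u \<Longrightarrow> u < s \<Longrightarrow> N j u \<omega> = 0"
      using first_jump[of "\<lambda>t. N j t \<omega>" t] elim(1) \<open>j \<in> {1..k}\<close> \<open>0 \<le> t\<close> by metis
    have others: "N i u \<omega> = 0" if "i \<in> {1..k}" "i \<noteq> j" "0 \<le> u" "u \<le> t" for i u
    proof -
      have "N i u \<omega> \<le> N i t \<omega>" using elim(1) that mono_onD[of "{0..}" "\<lambda>t. N i t \<omega>" u t] by auto
      with one that show ?thesis by simp
    qed
    have init: "M u \<omega> = M 0 \<omega>" if "0 \<le> u" "u < s" for u
    proof -
      have "N i 0 \<omega> = N i u \<omega>" if "i \<in> {1..k}" for i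
        using others[of i u] s \<open>0 \<le> u\<close> \<open>u < s\<close> that elim(1) by (cases "i = j") auto
      then show ?thesis using elim(2) that by blast
    qed
    have "left_lim (\<lambda>u. N j u \<omega>) s = 0" using s by (intro left_lim_eqI[of 0]) auto
    then have "M s \<omega> = meteor_hit k j (\<lambda>x. left_lim (\<lambda>u. M u \<omega> x) s)"
      using elim(3) s \<open>j \<in> {1..k}\<close> by auto
    moreover have "left_lim (\<lambda>u. M u \<omega> x) s = M 0 \<omega> x" for x
    proof (rule left_lim_eqI)
      show "M u \<omega> x = M 0 \<omega> x" if "0 \<le> u" "u < s" for u using init[OF that] by simp
    qed fact
    moreover have "M t \<omega> = M s \<omega>"
    proof -
      have "N i s \<omega> = N i t \<omega>" if "i \<in> {1..k}" for i
        using others[of i s] others[of i t] s \<open>0 \<le> t\<close> that \<open>N j t \<omega> = 1\<close> by (cases "i = j") auto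
      then show ?thesis using elim(2) s by (metis less_imp_le)
    qed
    ultimately show "M t \<omega> = meteor_hit k j (M 0 \<omega>)" by simp
  qed
qed

section \<open>Distribution of the hit counts\<close>

lemma measurable_N [measurable]:
  "j \<in> {1..k} \<Longrightarrow> 0 \<le> t \<Longrightarrow> N j t \<in> P \<rightarrow>\<^sub>M count_space UNIV"
  by (rule poisson_process.measurable_N[OF poisson])

lemma prob_N:
  assumes "j \<in> {1..k}" "0 < t"
  shows "prob {\<omega> \<in> space P. N j t \<omega> = n} = pmf (poisson_pmf t) n"
proof -
  interpret pp: poisson_process P 1 "N j" by (rule poisson) fact
  have [measurable]: "N j 0 \<in> P \<rightarrow>\<^sub>M count_space UNIV" "N j t \<in> P \<rightarrow>\<^sub>M count_space UNIV"
    using assms by auto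
  have "prob {\<omega> \<in> space P. N j t \<omega> = n} = prob {\<omega> \<in> space P. N j t \<omega> - N j 0 \<omega> = n}"
    using pp.counting_path by (intro finite_measure_eq_AE) (auto elim!: eventually_mono)
  also have "\<dots> = measure (distr P (count_space UNIV) (\<lambda>\<omega>. N j t \<omega> - N j 0 \<omega>)) {n}"
    by (subst measure_distr) (auto intro!: arg_cong[where f = prob])
  also have "\<dots> = pmf (poisson_pmf t) n"
    using pp.poisson_increments[of 0 t] assms by (simp add: measure_pmf_single)
  finally show ?thesis .
qed

lemma prob_counts:
  assumes "0 < t"
  shows "prob {\<omega> \<in> space P. \<forall>i\<in>{1..k}. N i t \<omega> = c i} = (\<Prod>i=1..k. pmf (poisson_pmf t) (c i))"
proof -
  have "indep_vars (\<lambda>_. count_space UNIV) (\<lambda>j \<omega>. (\<lambda>w. w t) (\<lambda>t\<in>{0..}. N j t \<omega>)) {1..k}"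
    using indep_poisson by (rule indep_vars_compose2) (measurable, use assms in auto)
  then have "indep_vars (\<lambda>_. count_space UNIV) (\<lambda>j. N j t) {1..k}"
    using assms by simp
  then have "prob (\<Inter>i\<in>{1..k}. N i t -` {c i} \<inter> space P) =
      (\<Prod>i\<in>{1..k}. prob (N i t -` {c i} \<inter> space P))"
    by (rule indep_varsD) (use k_ge_3 in auto)
  moreover have "(\<Inter>i\<in>{1..k}. N i t -` {c i} \<inter> space P) =
      {\<omega> \<in> space P. \<forall>i\<in>{1..k}. N i t \<omega> = c i}"
    using k_ge_3 by fastforce
  moreover have "prob (N i t -` {c i} \<inter> space P) = pmf (poisson_pmf t) (c i)" if "i \<in> {1..k}" for i
    using prob_N[OF that assms] by (simp add: vimage_def Int_def conj_commute)
  ultimately show ?thesis by simp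
qed

lemma prob_initial_and_counts:
  assumes "0 < t" and R: "Measurable.pred (state_space k) R"
  shows "prob {\<omega> \<in> space P. R (M 0 \<omega>) \<and> (\<forall>i\<in>{1..k}. N i t \<omega> = c i)} =
    prob {\<omega> \<in> space P. R (M 0 \<omega>)} * (\<Prod>i=1..k. pmf (poisson_pmf t) (c i))"
proof -
  let ?A = "{\<omega> \<in> space P. R (M 0 \<omega>)}" and ?B = "{\<omega> \<in> space P. \<forall>i\<in>{1..k}. N i t \<omega> = c i}"
  let ?paths = "\<lambda>\<omega>. \<lambda>(j, t)\<in>{1..k} \<times> {0..}. N j t \<omega>"
  let ?PN = "\<Pi>\<^sub>M jt\<in>{1..k} \<times> {0::real..}. count_space (UNIV :: nat set)"
  have M0: "M 0 \<in> P \<rightarrow>\<^sub>M state_space k" by (rule measurable_M) simp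
  have "{m \<in> space (state_space k). R m} \<in> sets (state_space k)" using R by measurable
  then have "M 0 -` {m \<in> space (state_space k). R m} \<inter> space P
      \<in> sets (vimage_algebra (space P) (M 0) (state_space k))"
    by (rule in_vimage_algebra)
  moreover have "M 0 -` {m \<in> space (state_space k). R m} \<inter> space P = ?A"
    using measurable_space[OF M0] by auto
  ultimately have A: "?A \<in> sets (vimage_algebra (space P) (M 0) (state_space k))" by simp
  have "{w \<in> space ?PN. \<forall>i\<in>{1..k}. w (i, t) = c i} \<in> sets ?PN"
    by (measurable, use \<open>0 < t\<close> in auto)
  then have "?paths -` {w \<in> space ?PN. \<forall>i\<in>{1..k}. w (i, t) = c i} \<inter> space P
      \<in> sets (vimage_algebra (space P) ?paths ?PN)"
    by (rule in_vimage_algebra)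
  moreover have "?paths -` {w \<in> space ?PN. \<forall>i\<in>{1..k}. w (i, t) = c i} \<inter> space P = ?B"
    using \<open>0 < t\<close> by (auto simp: space_PiM PiE_def)
  ultimately have B: "?B \<in> sets (vimage_algebra (space P) ?paths ?PN)" by simp
  have "prob (?A \<inter> ?B) = prob ?A * prob ?B"
    using indep_initial A B by (rule indep_setD)
  moreover have "?A \<inter> ?B = {\<omega> \<in> space P. R (M 0 \<omega>) \<and> (\<forall>i\<in>{1..k}. N i t \<omega> = c i)}" by auto
  ultimately show ?thesis using prob_counts[OF \<open>0 < t\<close>] by simp
qed

end

context stationary_meteor_process
begin

section \<open>The balance identity\<close>

lemma prob_stationary:
  assumes "0 \<le> t" and R [measurable]: "Measurable.pred (state_space k) R"
  shows "prob {\<omega> \<in> space P. R (M t \<omega>)} = prob {\<omega> \<in> space P. R (M 0 \<omega>)}"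
proof -
  have "prob {\<omega> \<in> space P. R (M s \<omega>)} = measure Q {m \<in> space (state_space k). R m}"
    if "0 \<le> s" for s
  proof -
    have [measurable]: "M s \<in> P \<rightarrow>\<^sub>M state_space k" using that by (rule measurable_M)
    have "{\<omega> \<in> space P. R (M s \<omega>)} = M s -` {m \<in> space (state_space k). R m} \<inter> space P"
      using measurable_space[of "M s" P "state_space k"] by auto
    moreover have "measure (distr P (state_space k) (M s)) {m \<in> space (state_space k). R m} =
        prob (M s -` {m \<in> space (state_space k). R m} \<inter> space P)"
      by (rule measure_distr) measurable
    ultimately show ?thesis using invariant_law[OF that] by simp
  qed
  from this[of t] this[of 0] show ?thesis using assms by simp
qed

lemma measurable_M0 [measurable]: "M 0 \<in> P \<rightarrow>\<^sub>M state_space k"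
  by (rule measurable_M) simp

text \<open>
  The right-hand side is \<open>exp (k t)\<close> times the probability of at least two hits in \<open>[0, t]\<close>, the
  only case in which the configuration at time \<open>t\<close> is not controlled.
\<close>

lemma balance_estimate:
  assumes t: "0 < t" and R [measurable]: "Measurable.pred (state_space k) R"
  defines "p \<equiv> prob {\<omega> \<in> space P. R (M 0 \<omega>)}"
    and "q \<equiv> \<lambda>j. prob {\<omega> \<in> space P. R (meteor_hit k j (M 0 \<omega>))}"
  shows "t * \<bar>(\<Sum>j=1..k. q j) - real k * p\<bar> \<le> exp (real k * t) - 1 - real k * t"
proof -
  have [measurable]: "M t \<in> P \<rightarrow>\<^sub>M state_space k" using t by (intro measurable_M) simp
  have [measurable]: "N i t \<in> P \<rightarrow>\<^sub>M count_space UNIV" if "i \<in> {1..k}" for i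
    using that t by (intro measurable_N) auto
  \<comment> \<open>Index 0, which is not a site, stands for the absence of hits, so that \<open>C j\<close> covers
    both cases.\<close>
  define post where "post j m = (if j = 0 then m else meteor_hit k j m)" for j m
  have [measurable]: "post j \<in> state_space k \<rightarrow>\<^sub>M state_space k" if "j \<in> {0..k}" for j
    using that measurable_meteor_hit[of j k] by (cases "j = 0") (auto simp: post_def[abs_def])
  have post0: "post 0 = (\<lambda>m. m)" and postj: "\<And>j. j \<in> {1..k} \<Longrightarrow> post j = meteor_hit k j"
    by (auto simp: post_def[abs_def])
  define C where "C j = {\<omega> \<in> space P. \<forall>i\<in>{1..k}. N i t \<omega> = of_bool (i = j)}" for j
  have C [measurable]: "C j \<in> events" for j unfolding C_def by measurable
  define A where "A = {\<omega> \<in> space P. R (M t \<omega>)}"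
  have A [measurable]: "A \<in> events" unfolding A_def by measurable
  have pA: "prob A = p" unfolding A_def p_def using t by (intro prob_stationary R) auto
  have disj: "disjoint_family_on C {0..k}"
  proof -
    have "C i \<inter> C j = {}" if ij: "i \<in> {0..k}" "j \<in> {0..k}" "i < j" for i j
    proof -
      have "j \<in> {1..k}" using ij by auto
      then show ?thesis using \<open>i < j\<close> unfolding C_def by fastforce
    qed
    then show ?thesis unfolding disjoint_family_on_def by (metis Int_commute linorder_neqE_nat)
  qed
  define w where "w j = (\<Prod>i=1..k. pmf (poisson_pmf t) (of_bool (i = j)))" for j :: nat
  have w0: "w 0 = exp (- (real k * t))"
  proof -
    have "w 0 = (\<Prod>i=1..k. exp (- t))" unfolding w_def using t by (intro prod.cong) auto
    then show ?thesis by (simp add: exp_of_nat_mult[symmetric])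
  qed
  have w1: "w j = t * exp (- (real k * t))" if "j \<in> {1..k}" for j
  proof -
    have "w j = (\<Prod>i=1..k. (if i = j then t else 1) * exp (- t))"
      unfolding w_def using t by (intro prod.cong) auto
    also have "\<dots> = (\<Prod>i=1..k. if i = j then t else 1) * (\<Prod>i=1..k. exp (- t))"
      by (rule prod.distrib)
    also have "(\<Prod>i=1..k. if i = j then t else 1) = t" using that by simp
    finally show ?thesis by (simp add: exp_of_nat_mult[symmetric])
  qed
  have pC: "prob (C j) = w j" for j
    unfolding C_def w_def by (rule prob_counts[OF t])
  have AC: "prob (A \<inter> C j) = prob {\<omega> \<in> space P. R (post j (M 0 \<omega>))} * w j"
    if j: "j \<in> {0..k}" for j
  proof -
    have [measurable]: "Measurable.pred (state_space k) (\<lambda>m. R (post j m))"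
      using j by measurable
    have "AE \<omega> in P. (\<forall>i\<in>{1..k}. N i t \<omega> = of_bool (i = j)) \<longrightarrow> M t \<omega> = post j (M 0 \<omega>)"
    proof (cases "j = 0")
      case True
      then show ?thesis using AE_no_jump[of t] t by (auto elim!: eventually_mono simp: post_def)
    next
      case False
      then show ?thesis using AE_one_jump[of t j] t j by (auto simp: post_def)
    qed
    then have "prob (A \<inter> C j) =
        prob {\<omega> \<in> space P. R (post j (M 0 \<omega>)) \<and> (\<forall>i\<in>{1..k}. N i t \<omega> = of_bool (i = j))}"
      by (intro finite_measure_eq_AE) (auto elim!: eventually_mono simp: A_def C_def)
    also have "\<dots> = prob {\<omega> \<in> space P. R (post j (M 0 \<omega>))} * w j"
      unfolding w_def by (rule prob_initial_and_counts[OF t]) measurable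
    finally show ?thesis .
  qed
  have split: "sum f {0..k} = f 0 + sum f {1..k}" for f :: "nat \<Rightarrow> real"
    by (simp add: sum.atLeast_Suc_atMost)
  define e where "e = exp (- (real k * t))"
  define T where "T = (\<Sum>j=1..k. q j)"
  have UA: "prob (\<Union>j\<in>{0..k}. A \<inter> C j) = p * e + t * e * T"
  proof -
    have "prob (\<Union>j\<in>{0..k}. A \<inter> C j) = (\<Sum>j\<in>{0..k}. prob (A \<inter> C j))"
      using disj by (intro finite_measure_finite_Union) (auto simp: disjoint_family_on_def)
    also have "\<dots> = p * e + (\<Sum>j=1..k. q j * (t * e))"
      unfolding split using AC w0 w1 by (auto simp: post0 postj p_def q_def e_def intro!: sum.cong)
    finally show ?thesis by (simp add: T_def sum_distrib_left sum_distrib_right mult_ac)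
  qed
  have UC: "prob (\<Union>j\<in>{0..k}. C j) = e + real k * t * e"
  proof -
    have "prob (\<Union>j\<in>{0..k}. C j) = (\<Sum>j\<in>{0..k}. prob (C j))"
      using disj by (intro finite_measure_finite_Union) auto
    also have "\<dots> = e + real k * t * e" unfolding split pC using w0 w1 by (simp add: e_def)
    finally show ?thesis .
  qed
  have "prob (\<Union>j\<in>{0..k}. A \<inter> C j) \<le> prob A"
    by (intro finite_measure_mono) auto
  then have lower: "p * e + t * e * T \<le> p" using UA pA by simp
  have upper: "p \<le> p * e + t * e * T + (1 - (e + real k * t * e))"
  proof -
    have "prob A \<le> prob ((\<Union>j\<in>{0..k}. A \<inter> C j) \<union> (space P - (\<Union>j\<in>{0..k}. C j)))"
      using sets.sets_into_space[OF A] by (intro finite_measure_mono) auto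
    also have "\<dots> \<le> prob (\<Union>j\<in>{0..k}. A \<inter> C j) + prob (space P - (\<Union>j\<in>{0..k}. C j))"
      by (intro measure_Un_le) auto
    also have "prob (space P - (\<Union>j\<in>{0..k}. C j)) = 1 - prob (\<Union>j\<in>{0..k}. C j)"
      by (rule prob_compl) auto
    finally show ?thesis using UA UC pA by simp
  qed
  define r where "r = 1 - (e + real k * t * e)"
  have "0 \<le> r" using UC prob_le_1[of "\<Union>j\<in>{0..k}. C j"] by (simp add: r_def)
  moreover have "0 \<le> p" "p \<le> 1" by (auto simp: p_def)
  ultimately have pr: "0 \<le> p * r" "p * r \<le> r" by (auto simp: mult_left_le_one_le)
  have eq: "t * e * (T - real k * p) = (p * e + t * e * T - p) + p * r"
    by (simp add: r_def algebra_simps)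
  have "\<bar>t * e * (T - real k * p)\<bar> \<le> r"
    unfolding eq using lower upper pr by (auto simp: r_def[symmetric])
  then have "e * (t * \<bar>T - real k * p\<bar>) \<le> r" using t by (simp add: abs_mult e_def mult_ac)
  also have "r = e * (exp (real k * t) - 1 - real k * t)"
    by (simp add: r_def e_def algebra_simps exp_minus_inverse)
  finally show ?thesis by (simp add: e_def T_def)
qed

text \<open>
  The error in the preceding estimate is quadratic in \<open>t\<close>; divide by \<open>t\<close> and let \<open>t\<close> tend to 0.
\<close>

lemma balance:
  assumes R: "Measurable.pred (state_space k) R"
  shows "(\<Sum>j=1..k. prob {\<omega> \<in> space P. R (meteor_hit k j (M 0 \<omega>))}) =
    real k * prob {\<omega> \<in> space P. R (M 0 \<omega>)}"
proof -
  define g where "g = \<bar>(\<Sum>j=1..k. prob {\<omega> \<in> space P. R (meteor_hit k j (M 0 \<omega>))}) -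
    real k * prob {\<omega> \<in> space P. R (M 0 \<omega>)}\<bar>"
  have k: "real k > 0" using k_ge_3 by simp
  have small: "g \<le> real k ^ 2 * t" if t: "0 < t" "t \<le> 1 / real k" for t
  proof -
    have "t * g \<le> exp (real k * t) - 1 - real k * t"
      unfolding g_def using t(1) R by (rule balance_estimate)
    also have "\<dots> \<le> (real k * t) ^ 2"
      using exp_bound[of "real k * t"] t k by (simp add: field_simps)
    finally have "t * g \<le> t * (real k ^ 2 * t)" by (simp add: power2_eq_square mult_ac)
    then show ?thesis using t by simp
  qed
  have "((\<lambda>t. real k ^ 2 * t) \<longlongrightarrow> real k ^ 2 * 0) (at_right 0)"
    by (intro tendsto_intros)
  moreover have "eventually (\<lambda>t. g \<le> real k ^ 2 * t) (at_right 0)"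
    using eventually_at_right_less[of 0] eventually_at_right_real[of 0 "1 / real k"] k
    by (auto elim!: eventually_mono intro!: small)
  ultimately have "g \<le> real k ^ 2 * 0" by (rule tendsto_lowerbound) simp
  then show ?thesis by (simp add: g_def)
qed

section \<open>Empty sites are not adjacent\<close>

text \<open>
  If every site of \<open>S\<close> has a neighbour in \<open>S\<close>, then \<open>S\<close> can be empty after a hit only if it
  was empty before: a hit at a site with positive mass makes its neighbours positive. So all
  terms of the balance identity for the event that \<open>S\<close> is empty have the same sign and must vanish.
  The term of a site \<open>j\<close> adjacent to \<open>S\<close> is the probability that \<open>S\<close> is empty but \<open>j\<close> is not.
\<close>

lemma zero_set_absorbs_neighbour:
  assumes S: "S \<subseteq> {1..k}" and paired: "\<And>x. x \<in> S \<Longrightarrow> \<exists>y\<in>S. {x, y} \<in> circular_edges k"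
    and j: "j \<in> {1..k}" and y: "y \<in> S" "{j, y} \<in> circular_edges k"
  shows "prob {\<omega> \<in> space P. \<forall>x\<in>insert j S. M 0 \<omega> x = 0} = prob {\<omega> \<in> space P. \<forall>x\<in>S. M 0 \<omega> x = 0}"
proof -
  let ?Z = "\<lambda>m :: nat \<Rightarrow> real. \<forall>x\<in>S. m x = 0"
  have zeros [measurable]: "Measurable.pred (state_space k) (\<lambda>m. \<forall>x\<in>A. m x = 0)" if "A \<subseteq> {1..k}" for A
  proof -
    have [measurable]: "countable A" using that by (meson countable_finite finite_atLeastAtMost finite_subset)
    have [measurable]: "(\<lambda>m. m x) \<in> borel_measurable (state_space k)" if "x \<in> A" for x
      using that \<open>A \<subseteq> {1..k}\<close> by (intro measurable_mass) auto
    show ?thesis by measurable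
  qed
  have mZ: "Measurable.pred (state_space k) ?Z" using S by (rule zeros)
  have before: "\<forall>x\<in>S. m x = 0"
    if m: "\<forall>x\<in>{1..k}. m x \<ge> 0" and i: "i \<in> {1..k}" and post: "?Z (meteor_hit k i m)" for i m
  proof
    fix x assume x: "x \<in> S"
    show "m x = 0"
    proof (cases "x = i")
      case True
      obtain z where z: "z \<in> S" "{x, z} \<in> circular_edges k" using paired x by blast
      then have "m z + m i / 2 = 0"
        using post meteor_hit_neighbour[OF k_ge_3 i, of z m] S True by auto
      moreover have "m z \<ge> 0" "m i \<ge> 0" using m z S i by auto
      ultimately show ?thesis using True by auto
    next
      case False
      have "meteor_hit k i m x \<ge> m x"
        using m i x S False by (auto simp: meteor_hit_apply[OF k_ge_3 i])
      moreover have "m x \<ge> 0" using m x S by auto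
      ultimately show ?thesis using post x by force
    qed
  qed
  define D where "D i = prob {\<omega> \<in> space P. ?Z (M 0 \<omega>)} -
    prob {\<omega> \<in> space P. ?Z (meteor_hit k i (M 0 \<omega>))}" for i
  have "D i \<ge> 0" if i: "i \<in> {1..k}" for i
  proof -
    have "prob {\<omega> \<in> space P. ?Z (meteor_hit k i (M 0 \<omega>))} \<le> prob {\<omega> \<in> space P. ?Z (M 0 \<omega>)}"
      using initial_nonneg before[OF _ i] mZ
      by (intro finite_measure_mono_AE) (auto elim!: eventually_mono)
    then show ?thesis by (simp add: D_def)
  qed
  moreover have "(\<Sum>i=1..k. D i) = 0" using balance[OF mZ] by (simp add: D_def sum_subtractf)
  ultimately have "D j = 0" using sum_nonneg_eq_0_iff[of "{1..k}" D] j by simp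
  have both: "?Z m \<and> m j = 0"
    if "\<forall>x\<in>{1..k}. m x \<ge> 0" "?Z (meteor_hit k j m)" for m
  proof -
    have "?Z m" using before that j by blast
    moreover have "m y + m j / 2 = 0"
      using that(2) meteor_hit_neighbour[OF k_ge_3 j, of y m] y S by auto
    ultimately show ?thesis using y by auto
  qed
  have "insert j S \<subseteq> {1..k}" using S j by auto
  note [measurable] = zeros[OF this] mZ
  have "prob {\<omega> \<in> space P. ?Z (meteor_hit k j (M 0 \<omega>))} \<le>
      prob {\<omega> \<in> space P. \<forall>x\<in>insert j S. M 0 \<omega> x = 0}"
  proof (rule finite_measure_mono_AE)
    show "AE \<omega> in P. \<omega> \<in> {\<omega> \<in> space P. ?Z (meteor_hit k j (M 0 \<omega>))} \<longrightarrow>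
        \<omega> \<in> {\<omega> \<in> space P. \<forall>x\<in>insert j S. M 0 \<omega> x = 0}"
      using initial_nonneg by eventually_elim (use both in blast)
    show "{\<omega> \<in> space P. \<forall>x\<in>insert j S. M 0 \<omega> x = 0} \<in> events" by measurable
  qed
  moreover have "prob {\<omega> \<in> space P. \<forall>x\<in>insert j S. M 0 \<omega> x = 0} \<le> prob {\<omega> \<in> space P. ?Z (M 0 \<omega>)}"
    by (intro finite_measure_mono) auto
  ultimately show ?thesis using \<open>D j = 0\<close> by (simp add: D_def)
qed

text \<open>
  The interval is enlarged site by site until it is the whole graph, which carries mass \<open>k\<close>.
\<close>

lemma prob_zero_interval:
  assumes "1 \<le> a" "a < b" "b \<le> k"
  shows "prob {\<omega> \<in> space P. \<forall>x\<in>{a..b}. M 0 \<omega> x = 0} = 0"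
  using assms
proof (induction "k + a - b" arbitrary: a b rule: less_induct)
  case less
  have paired: "\<exists>y\<in>{a..b}. {x, y} \<in> circular_edges k" if "x \<in> {a..b}" for x
  proof (cases "x = b")
    case True
    have "{b, b - 1} \<in> circular_edges k"
      using less.prems k_ge_3 by (subst circular_edges_iff) auto
    then show ?thesis using True less.prems by (intro bexI[of _ "b - 1"]) auto
  next
    case False
    then show ?thesis using less.prems k_ge_3 that
      by (intro bexI[of _ "x + 1"]) (auto simp: circular_edges_iff)
  qed
  have sub: "{a..b} \<subseteq> {1..k}" using less.prems by auto
  consider "b < k" | "1 < a" | "a = 1" "b = k" using less.prems by linarith
  then show ?case
  proof cases
    case 1
    have "prob {\<omega> \<in> space P. \<forall>x\<in>insert (b + 1) {a..b}. M 0 \<omega> x = 0} =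
        prob {\<omega> \<in> space P. \<forall>x\<in>{a..b}. M 0 \<omega> x = 0}"
    proof (rule zero_set_absorbs_neighbour[OF sub paired])
      show "{b + 1, b} \<in> circular_edges k"
        using 1 less.prems k_ge_3 by (subst circular_edges_iff) auto
    qed (use 1 less.prems in auto)
    moreover have "insert (b + 1) {a..b} = {a..b + 1}" using less.prems by auto
    moreover have "prob {\<omega> \<in> space P. \<forall>x\<in>{a..b + 1}. M 0 \<omega> x = 0} = 0"
      using less.prems 1 by (intro less.hyps) auto
    ultimately show ?thesis by metis
  next
    case 2
    have "prob {\<omega> \<in> space P. \<forall>x\<in>insert (a - 1) {a..b}. M 0 \<omega> x = 0} =
        prob {\<omega> \<in> space P. \<forall>x\<in>{a..b}. M 0 \<omega> x = 0}"
    proof (rule zero_set_absorbs_neighbour[OF sub paired])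
      show "{a - 1, a} \<in> circular_edges k"
        using 2 less.prems k_ge_3 by (subst circular_edges_iff) auto
    qed (use 2 less.prems in auto)
    moreover have "insert (a - 1) {a..b} = {a - 1..b}" using 2 less.prems by auto
    moreover have "prob {\<omega> \<in> space P. \<forall>x\<in>{a - 1..b}. M 0 \<omega> x = 0} = 0"
      using less.prems 2 by (intro less.hyps) auto
    ultimately show ?thesis by metis
  next
    case 3
    have "AE m in distr P (state_space k) (M 0). (\<Sum>j=1..k. m j) = real k"
      unfolding initial_law by (rule total_mass)
    then have "AE \<omega> in P. (\<Sum>j=1..k. M 0 \<omega> j) = real k"
      by (rule AE_distrD[rotated]) measurable
    then have "AE \<omega> in P. \<not> (\<forall>x\<in>{a..b}. M 0 \<omega> x = 0)"
    proof eventually_elim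
      case (elim \<omega>)
      show ?case
      proof
        assume "\<forall>x\<in>{a..b}. M 0 \<omega> x = 0"
        then have "(\<Sum>j=1..k. M 0 \<omega> j) = 0" using 3 by (intro sum.neutral) auto
        with elim k_ge_3 show False by simp
      qed
    qed
    then show ?thesis
      by (intro prob_eq_0_AE)
  qed
qed

text \<open>
  The pair of adjacent sites \<open>k\<close> and \<open>1\<close> is left out, so that all arguments take place on
  intervals of sites that do not wrap around.
\<close>

definition regular :: "(nat \<Rightarrow> real) \<Rightarrow> bool" where
  "regular m \<longleftrightarrow> (\<forall>x\<in>{1..k}. 0 \<le> m x) \<and> (\<forall>x\<in>{1..<k}. 0 < m x \<or> 0 < m (x + 1))"

lemma regular_nonneg: "regular m \<Longrightarrow> x \<in> {1..k} \<Longrightarrow> 0 \<le> m x"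
  by (simp add: regular_def)

lemma regular_adjacent:
  assumes "regular m" "x \<in> {1..<k}"
  shows "0 < m x + m (x + 1) / 2" "0 < m (x + 1) + m x / 2"
proof -
  have "0 \<le> m x" "0 \<le> m (x + 1)" "0 < m x \<or> 0 < m (x + 1)"
    using assms by (auto simp: regular_def)
  then show "0 < m x + m (x + 1) / 2" "0 < m (x + 1) + m x / 2" by auto
qed

lemma AE_regular: "AE \<omega> in P. regular (M 0 \<omega>)"
proof -
  have "AE \<omega> in P. \<forall>x\<in>{1..<k}. \<not> (\<forall>z\<in>{x..x + 1}. M 0 \<omega> z = 0)"
  proof (intro AE_finite_allI)
    fix x assume x: "x \<in> {1..<k}"
    have "prob {\<omega> \<in> space P. \<forall>z\<in>{x..x + 1}. M 0 \<omega> z = 0} = 0"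
      using x by (intro prob_zero_interval) auto
    moreover have "{\<omega> \<in> space P. \<forall>z\<in>{x..x + 1}. M 0 \<omega> z = 0} \<in> events"
    proof -
      have [measurable]: "(\<lambda>\<omega>. M 0 \<omega> z) \<in> borel_measurable P" if "z \<in> {x..x + 1}" for z
        using that x by (intro measurable_compose[OF measurable_M0 measurable_mass]) auto
      show ?thesis by measurable
    qed
    ultimately show "AE \<omega> in P. \<not> (\<forall>z\<in>{x..x + 1}. M 0 \<omega> z = 0)"
      by (subst (asm) prob_eq_0) auto
  qed simp
  with initial_nonneg show ?thesis
  proof eventually_elim
    case (elim \<omega>)
    have "0 < M 0 \<omega> x \<or> 0 < M 0 \<omega> (x + 1)" if x: "x \<in> {1..<k}" for x
    proof -
      have "{x..x + 1} = {x, x + 1}" by auto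
      then have "M 0 \<omega> x \<noteq> 0 \<or> M 0 \<omega> (x + 1) \<noteq> 0" using elim(2) x by auto
      moreover have "0 \<le> M 0 \<omega> x" "0 \<le> M 0 \<omega> (x + 1)" using elim(1) x by auto
      ultimately show ?thesis by linarith
    qed
    with elim(1) show ?case by (auto simp: regular_def)
  qed
qed

lemma prob_hit_eq:
  assumes R: "Measurable.pred (state_space k) R" and R': "Measurable.pred (state_space k) R'"
    and j: "j \<in> {1..k}" and eq: "\<And>m. regular m \<Longrightarrow> R (meteor_hit k j m) \<longleftrightarrow> R' m"
  shows "prob {\<omega> \<in> space P. R (meteor_hit k j (M 0 \<omega>))} = prob {\<omega> \<in> space P. R' (M 0 \<omega>)}"
proof (rule finite_measure_eq_AE)
  note [measurable] = R R' measurable_meteor_hit[OF j]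
  show "AE \<omega> in P. (\<omega> \<in> {\<omega> \<in> space P. R (meteor_hit k j (M 0 \<omega>))}) =
      (\<omega> \<in> {\<omega> \<in> space P. R' (M 0 \<omega>)})"
    using AE_regular by eventually_elim (simp add: eq)
  show "{\<omega> \<in> space P. R (meteor_hit k j (M 0 \<omega>))} \<in> events" by measurable
  show "{\<omega> \<in> space P. R' (M 0 \<omega>)} \<in> events" by measurable
qed

section \<open>Runs of positive sites\<close>

text \<open>
  The balance identity for an event that depends on the sites of a window: among the hits
  in the window \<open>I\<close>, only those at \<open>l\<close> and \<open>r\<close> can leave the event true, and hits outside \<open>I\<close> do
  not affect it. The contribution of the sites outside \<open>I\<close> cancels, which replaces \<open>k\<close> by
  \<open>card I\<close>.
\<close>

lemma balance_window:
  assumes R: "Measurable.pred (state_space k) R"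
    and Rl: "Measurable.pred (state_space k) Rl" and Rr: "Measurable.pred (state_space k) Rr"
    and I: "I \<subseteq> {1..k}" "l \<in> I" "r \<in> I" "l \<noteq> r"
    and fatal: "\<And>j m. j \<in> I - {l, r} \<Longrightarrow> regular m \<Longrightarrow> \<not> R (meteor_hit k j m)"
    and neutral: "\<And>j m. j \<in> {1..k} - I \<Longrightarrow> regular m \<Longrightarrow> R (meteor_hit k j m) \<longleftrightarrow> R m"
    and left: "\<And>m. regular m \<Longrightarrow> R (meteor_hit k l m) \<longleftrightarrow> Rl m"
    and right: "\<And>m. regular m \<Longrightarrow> R (meteor_hit k r m) \<longleftrightarrow> Rr m"
  shows "real (card I) * prob {\<omega> \<in> space P. R (M 0 \<omega>)} =
    prob {\<omega> \<in> space P. Rl (M 0 \<omega>)} + prob {\<omega> \<in> space P. Rr (M 0 \<omega>)}"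
proof -
  let ?q = "\<lambda>j. prob {\<omega> \<in> space P. R (meteor_hit k j (M 0 \<omega>))}"
  let ?p = "prob {\<omega> \<in> space P. R (M 0 \<omega>)}"
  have fin: "finite I" using I finite_subset by blast
  have out: "?q j = ?p" if "j \<in> {1..k} - I" for j
    using that neutral by (intro prob_hit_eq[OF R R]) auto
  have dead: "?q j = 0" if "j \<in> I - {l, r}" for j
    using prob_hit_eq[OF R, of "\<lambda>_. False" j] fatal that I by auto
  have "real k * ?p = sum ?q {1..k}" using balance[OF R] by simp
  also have "\<dots> = sum ?q ({1..k} - I) + sum ?q I" using I by (intro sum.subset_diff) auto
  also have "sum ?q ({1..k} - I) = (real k - real (card I)) * ?p"
    using out card_mono[of "{1..k}" I] I fin by (simp add: card_Diff_subset of_nat_diff)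
  also have "sum ?q I = sum ?q {l, r}"
    using I fin dead by (intro sum.mono_neutral_right) auto
  also have "\<dots> = ?q l + ?q r" using I by simp
  also have "?q l = prob {\<omega> \<in> space P. Rl (M 0 \<omega>)}"
    using I left by (intro prob_hit_eq[OF R Rl]) auto
  also have "?q r = prob {\<omega> \<in> space P. Rr (M 0 \<omega>)}"
    using I right by (intro prob_hit_eq[OF R Rr]) auto
  finally show ?thesis by (simp add: algebra_simps)
qed

lemma pred_positive:
  assumes "S \<subseteq> {1..k}"
  shows "Measurable.pred (state_space k) (\<lambda>m. \<forall>i\<in>S. 0 < m i)"
proof -
  have [measurable]: "countable S"
    using assms by (meson countable_finite finite_atLeastAtMost finite_subset)
  have [measurable]: "(\<lambda>m. m x) \<in> borel_measurable (state_space k)" if "x \<in> S" for x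
    using that assms by (intro measurable_mass) auto
  show ?thesis by measurable
qed

text \<open>
  The sites strictly between \<open>a\<close> and \<open>a + n + 1\<close> are required to be positive. The window
  consists of these sites and the two end points; a hit at an end point makes the adjacent site
  positive and hence shortens the run by one.
\<close>

lemma prob_positive_run:
  assumes "1 \<le> a" "a + n + 1 \<le> k"
  shows "prob {\<omega> \<in> space P. \<forall>i\<in>{a<..a + n}. 0 < M 0 \<omega> i} = 2 ^ (n + 1) / fact (n + 2)"
  using assms
proof (induction n arbitrary: a)
  case 0
  then show ?case by (simp add: prob_space numeral_2_eq_2)
next
  case (Suc n)
  let ?R = "\<lambda>m :: nat \<Rightarrow> real. \<forall>i\<in>{a<..a + Suc n}. 0 < m i"
  let ?Rl = "\<lambda>m :: nat \<Rightarrow> real. \<forall>i\<in>{a + 1<..a + 1 + n}. 0 < m i"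
  let ?Rr = "\<lambda>m :: nat \<Rightarrow> real. \<forall>i\<in>{a<..a + n}. 0 < m i"
  let ?r = "a + n + 2"
  note hit = meteor_hit_apply[OF k_ge_3]
  have "real (card {a..?r}) * prob {\<omega> \<in> space P. ?R (M 0 \<omega>)} =
      prob {\<omega> \<in> space P. ?Rl (M 0 \<omega>)} + prob {\<omega> \<in> space P. ?Rr (M 0 \<omega>)}"
  proof (rule balance_window)
    show "Measurable.pred (state_space k) ?R" "Measurable.pred (state_space k) ?Rl"
      "Measurable.pred (state_space k) ?Rr"
      using Suc.prems by (auto intro!: pred_positive)
  next
    fix j m assume j: "j \<in> {a..?r} - {a, ?r}"
    then have "meteor_hit k j m j = 0" using Suc.prems by (intro meteor_hit_self) auto
    moreover have "j \<in> {a<..a + Suc n}" using j by auto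
    ultimately show "\<not> ?R (meteor_hit k j m)" by (metis less_irrefl)
  next
    fix j m assume j: "j \<in> {1..k} - {a..?r}"
    have "meteor_hit k j m i = m i" if "i \<in> {a<..a + Suc n}" for i
      using that Suc.prems j by (subst hit) auto
    then show "?R (meteor_hit k j m) \<longleftrightarrow> ?R m" by simp
  next
    fix m assume m: "regular m"
    have "meteor_hit k a m (a + 1) = m (a + 1) + m a / 2" using Suc.prems by (subst hit) auto
    moreover have "0 < m (a + 1) + m a / 2" using regular_adjacent[OF m] Suc.prems by auto
    moreover have "meteor_hit k a m i = m i" if "i \<in> {a + 1<..a + 1 + n}" for i
      using Suc.prems that by (subst hit) auto
    moreover have "{a<..a + Suc n} = insert (a + 1) {a + 1<..a + 1 + n}" by auto
    ultimately show "?R (meteor_hit k a m) \<longleftrightarrow> ?Rl m" by simp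
  next
    fix m assume m: "regular m"
    have "meteor_hit k ?r m (a + n + 1) = m (a + n + 1) + m ?r / 2"
      using Suc.prems by (subst hit) auto
    moreover have "0 < m (a + n + 1) + m ?r / 2"
      using regular_adjacent[OF m, of "a + n + 1"] Suc.prems by auto
    moreover have "meteor_hit k ?r m i = m i" if "i \<in> {a<..a + n}" for i
      using Suc.prems that by (subst hit) auto
    moreover have "{a<..a + Suc n} = insert (a + n + 1) {a<..a + n}" by auto
    ultimately show "?R (meteor_hit k ?r m) \<longleftrightarrow> ?Rr m" by simp
  qed (use Suc.prems in auto)
  also have "prob {\<omega> \<in> space P. ?Rl (M 0 \<omega>)} = 2 ^ (n + 1) / fact (n + 2)"
    using Suc.prems by (intro Suc.IH) auto
  also have "prob {\<omega> \<in> space P. ?Rr (M 0 \<omega>)} = 2 ^ (n + 1) / fact (n + 2)"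
    using Suc.prems by (intro Suc.IH) auto
  also have "real (card {a..?r}) = real n + 3" by simp
  also have "2 ^ (n + 1) / fact (n + 2) + 2 ^ (n + 1) / fact (n + 2) =
      (2 ^ (Suc n + 1) / fact (n + 2) :: real)" by (simp del: fact_Suc)
  finally have "prob {\<omega> \<in> space P. ?R (M 0 \<omega>)} = 2 ^ (Suc n + 1) / fact (n + 2) / (real n + 3)"
    by (simp only: nonzero_eq_divide_eq mult.commute)
  then have "prob {\<omega> \<in> space P. ?R (M 0 \<omega>)} = 2 ^ (Suc n + 1) / ((real n + 3) * fact (n + 2))"
    by (simp only: divide_divide_eq_left mult.commute)
  also have "(real n + 3) * fact (n + 2) = (fact (Suc n + 2) :: real)" by simp
  finally show ?case .
qed

lemma prob_positive_then_zero:
  assumes x: "x \<in> {1..k}" and S: "S \<subseteq> {1..k}"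
  shows "prob {\<omega> \<in> space P. (\<forall>i\<in>S. 0 < M 0 \<omega> i) \<and> M 0 \<omega> x = 0} =
    prob {\<omega> \<in> space P. \<forall>i\<in>S. 0 < M 0 \<omega> i} - prob {\<omega> \<in> space P. \<forall>i\<in>insert x S. 0 < M 0 \<omega> i}"
proof -
  have ev: "{\<omega> \<in> space P. \<forall>i\<in>T. 0 < M 0 \<omega> i} \<in> events" if "T \<subseteq> {1..k}" for T
    using measurable_compose[OF measurable_M0 pred_positive[OF that]] by measurable
  have evx: "{\<omega> \<in> space P. (\<forall>i\<in>S. 0 < M 0 \<omega> i) \<and> M 0 \<omega> x = 0} \<in> events"
  proof -
    note [measurable] = measurable_compose[OF measurable_M0 pred_positive[OF S]]
      measurable_compose[OF measurable_M0 measurable_mass[OF x]]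
    show ?thesis by measurable
  qed
  let ?A = "{\<omega> \<in> space P. \<forall>i\<in>S. 0 < M 0 \<omega> i}"
  let ?B = "{\<omega> \<in> space P. \<forall>i\<in>insert x S. 0 < M 0 \<omega> i}"
  have "insert x S \<subseteq> {1..k}" using x S by auto
  note B = ev[OF this] and A = ev[OF S]
  have "prob {\<omega> \<in> space P. (\<forall>i\<in>S. 0 < M 0 \<omega> i) \<and> M 0 \<omega> x = 0} = prob (?A - ?B)"
  proof (rule finite_measure_eq_AE)
    show "AE \<omega> in P. (\<omega> \<in> {\<omega> \<in> space P. (\<forall>i\<in>S. 0 < M 0 \<omega> i) \<and> M 0 \<omega> x = 0}) = (\<omega> \<in> ?A - ?B)"
      using AE_regular
    proof eventually_elim
      case (elim \<omega>)
      show ?case using regular_nonneg[OF elim x] by auto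
    qed
  qed (use A B evx in auto)
  also have "\<dots> = prob ?A - prob ?B"
    using A B by (intro finite_measure_Diff) auto
  finally show ?thesis .
qed

lemma prob_vacant_site:
  assumes "1 \<le> a" "a + 2 \<le> k"
  shows "prob {\<omega> \<in> space P. M 0 \<omega> (a + 1) = 0} = 1 / 3"
proof -
  have run: "{a<..a + 1} = {a + 1}" by auto
  have "prob {\<omega> \<in> space P. M 0 \<omega> (a + 1) = 0} =
      prob (space P) - prob {\<omega> \<in> space P. \<forall>i\<in>{a<..a + 1}. 0 < M 0 \<omega> i}"
    using prob_positive_then_zero[of "a + 1" "{}"] assms run by simp
  also have "prob {\<omega> \<in> space P. \<forall>i\<in>{a<..a + 1}. 0 < M 0 \<omega> i} = 2 ^ (1 + 1) / fact (1 + 2)"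
    using assms by (intro prob_positive_run) auto
  finally show ?thesis by (simp add: prob_space fact_numeral)
qed

text \<open>
  The window extends the two empty sites \<open>a + 1\<close> and \<open>a + n + 2\<close> by one site on each side, since
  hits at \<open>a\<close> or \<open>a + n + 3\<close> also fill an empty site. A hit at one of the two empty
  sites achieves that this site is empty and its neighbour in the run is positive, so only the
  remaining \<open>n - 1\<close> sites of the run and the other empty site are a condition on the configuration
  before the hit.
\<close>

lemma prob_run_between_zeros:
  assumes "1 \<le> a" "1 \<le> n" "a + n + 3 \<le> k"
  shows "prob {\<omega> \<in> space P. (\<forall>i\<in>{a + 1<..a + n + 1}. 0 < M 0 \<omega> i) \<and>
      M 0 \<omega> (a + 1) = 0 \<and> M 0 \<omega> (a + n + 2) = 0} =
    real n * (real n + 3) * 2 ^ (n + 1) / fact (n + 4)"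
proof -
  obtain n' where n': "n = Suc n'" using \<open>1 \<le> n\<close> by (cases n) auto
  let ?l = "a + 1" and ?r = "a + n + 2"
  let ?R = "\<lambda>m :: nat \<Rightarrow> real. (\<forall>i\<in>{a + 1<..a + n + 1}. 0 < m i) \<and> m ?l = 0 \<and> m ?r = 0"
  let ?Rl = "\<lambda>m :: nat \<Rightarrow> real. (\<forall>i\<in>{a + 2<..a + 2 + n'}. 0 < m i) \<and> m ?r = 0"
  let ?Rr = "\<lambda>m :: nat \<Rightarrow> real. (\<forall>i\<in>{a + 1<..a + 1 + n'}. 0 < m i) \<and> m ?l = 0"
  note hit = meteor_hit_apply[OF k_ge_3]
  have "real (card {a..a + n + 3}) * prob {\<omega> \<in> space P. ?R (M 0 \<omega>)} =
      prob {\<omega> \<in> space P. ?Rl (M 0 \<omega>)} + prob {\<omega> \<in> space P. ?Rr (M 0 \<omega>)}"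
  proof (rule balance_window)
    have [measurable]: "(\<lambda>m. m ?l) \<in> borel_measurable (state_space k)"
      "(\<lambda>m. m ?r) \<in> borel_measurable (state_space k)"
      using assms by (auto intro!: measurable_mass)
    have [measurable]: "Measurable.pred (state_space k) (\<lambda>m. \<forall>i\<in>{a + 1<..a + n + 1}. 0 < m i)"
      "Measurable.pred (state_space k) (\<lambda>m. \<forall>i\<in>{a + 2<..a + 2 + n'}. 0 < m i)"
      "Measurable.pred (state_space k) (\<lambda>m. \<forall>i\<in>{a + 1<..a + 1 + n'}. 0 < m i)"
      using assms n' by (auto intro!: pred_positive)
    show "Measurable.pred (state_space k) ?R" "Measurable.pred (state_space k) ?Rl"
      "Measurable.pred (state_space k) ?Rr"
      by measurable
  next
    fix j m assume j: "j \<in> {a..a + n + 3} - {?l, ?r}" and m: "regular m"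
    consider "j = a" | "j = a + n + 3" | "j \<in> {a + 1<..a + n + 1}" using j by force
    then show "\<not> ?R (meteor_hit k j m)"
    proof cases
      case 1
      have "meteor_hit k a m ?l = m ?l + m a / 2" using assms by (subst hit) auto
      moreover have "0 < m ?l + m a / 2" using regular_adjacent[OF m, of a] assms by auto
      ultimately show ?thesis using 1 by simp
    next
      case 2
      have "meteor_hit k (a + n + 3) m ?r = m ?r + m (a + n + 3) / 2"
        using assms by (subst hit) auto
      moreover have "0 < m ?r + m (?r + 1) / 2" using regular_adjacent[OF m, of ?r] assms by auto
      moreover have "?r + 1 = a + n + 3" by simp
      ultimately have "0 < meteor_hit k (a + n + 3) m ?r" by metis
      with 2 show ?thesis by simp
    next
      case 3
      have "meteor_hit k j m j = 0" using assms 3 by (intro meteor_hit_self) auto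
      with 3 show ?thesis by (metis less_irrefl)
    qed
  next
    fix j m assume j: "j \<in> {1..k} - {a..a + n + 3}"
    have "meteor_hit k j m i = m i" if "i \<in> {?l..?r}" for i
      using that assms j by (subst hit) auto
    then show "?R (meteor_hit k j m) \<longleftrightarrow> ?R m" by simp
  next
    fix m assume m: "regular m"
    have "meteor_hit k ?l m (a + 2) = m (a + 2) + m ?l / 2" using assms by (subst hit) auto
    moreover have "0 < m (a + 2) + m ?l / 2" using regular_adjacent[OF m, of ?l] assms by auto
    moreover have "meteor_hit k ?l m ?l = 0" using assms by (intro meteor_hit_self) auto
    moreover have "meteor_hit k ?l m i = m i" if "i \<in> {a + 2<..?r}" for i
      using assms that by (subst hit) auto
    moreover have "{a + 1<..a + n + 1} = insert (a + 2) {a + 2<..a + 2 + n'}" using n' by auto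
    ultimately show "?R (meteor_hit k ?l m) \<longleftrightarrow> ?Rl m" using n' by simp
  next
    fix m assume m: "regular m"
    have "meteor_hit k ?r m (a + n + 1) = m (a + n + 1) + m ?r / 2" using assms by (subst hit) auto
    moreover have "0 < m (a + n + 1) + m ?r / 2"
      using regular_adjacent[OF m, of "a + n + 1"] assms by auto
    moreover have "meteor_hit k ?r m ?r = 0" using assms by (intro meteor_hit_self) auto
    moreover have "meteor_hit k ?r m i = m i" if "i \<in> {?l..a + n}" for i
      using assms that by (subst hit) auto
    moreover have "{a + 1<..a + n + 1} = insert (a + n + 1) {a + 1<..a + 1 + n'}" using n' by auto
    ultimately show "?R (meteor_hit k ?r m) \<longleftrightarrow> ?Rr m" using n' by simp
  qed (use assms in auto)
  also have "prob {\<omega> \<in> space P. ?Rl (M 0 \<omega>)} =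
      prob {\<omega> \<in> space P. \<forall>i\<in>{a + 2<..a + 2 + n'}. 0 < M 0 \<omega> i} -
      prob {\<omega> \<in> space P. \<forall>i\<in>insert ?r {a + 2<..a + 2 + n'}. 0 < M 0 \<omega> i}"
    using assms n' by (intro prob_positive_then_zero) auto
  also have "insert ?r {a + 2<..a + 2 + n'} = {a + 2<..a + 2 + n}" using n' by auto
  also have "prob {\<omega> \<in> space P. \<forall>i\<in>{a + 2<..a + 2 + n'}. 0 < M 0 \<omega> i} =
      2 ^ (n' + 1) / fact (n' + 2)"
    using assms n' by (intro prob_positive_run) auto
  also have "prob {\<omega> \<in> space P. \<forall>i\<in>{a + 2<..a + 2 + n}. 0 < M 0 \<omega> i} = 2 ^ (n + 1) / fact (n + 2)"
    using assms by (intro prob_positive_run) auto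
  also have "prob {\<omega> \<in> space P. ?Rr (M 0 \<omega>)} =
      prob {\<omega> \<in> space P. \<forall>i\<in>{a + 1<..a + 1 + n'}. 0 < M 0 \<omega> i} -
      prob {\<omega> \<in> space P. \<forall>i\<in>insert ?l {a + 1<..a + 1 + n'}. 0 < M 0 \<omega> i}"
    using assms n' by (intro prob_positive_then_zero) auto
  also have "insert ?l {a + 1<..a + 1 + n'} = {a<..a + n}" using n' by auto
  also have "prob {\<omega> \<in> space P. \<forall>i\<in>{a + 1<..a + 1 + n'}. 0 < M 0 \<omega> i} =
      2 ^ (n' + 1) / fact (n' + 2)"
    using assms n' by (intro prob_positive_run) auto
  also have "prob {\<omega> \<in> space P. \<forall>i\<in>{a<..a + n}. 0 < M 0 \<omega> i} = 2 ^ (n + 1) / fact (n + 2)"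
    using assms by (intro prob_positive_run) auto
  also have "real (card {a..a + n + 3}) = real n + 4" by simp
  also have "(2 ^ (n' + 1) / fact (n' + 2) - 2 ^ (n + 1) / fact (n + 2)) +
      (2 ^ (n' + 1) / fact (n' + 2) - 2 ^ (n + 1) / fact (n + 2)) =
      real n * 2 ^ (n + 1) / fact (n + 2)"
  proof -
    define f where "f = (fact (n' + 2) :: real)"
    have "f > 0" by (simp add: f_def del: fact_Suc)
    moreover have "(fact (n + 2) :: real) = (real n + 2) * f" using n' by (simp add: f_def)
    ultimately show ?thesis
      unfolding f_def[symmetric] using n' by (simp add: divide_simps) (simp add: algebra_simps)
  qed
  finally have "prob {\<omega> \<in> space P. ?R (M 0 \<omega>)} =
      real n * 2 ^ (n + 1) / fact (n + 2) / (real n + 4)"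
    by (simp only: nonzero_eq_divide_eq mult.commute)
  also have "\<dots> = real n * (real n + 3) * 2 ^ (n + 1) / fact (n + 4)"
  proof -
    have "(fact (n + 4) :: real) = (real n + 4) * ((real n + 3) * fact (n + 2))"
      by (simp add: numeral_eq_Suc) (simp add: algebra_simps)
    then show ?thesis by (simp add: divide_simps del: fact_Suc)
  qed
  finally show ?thesis .
qed

end

theorem theorem4p1:
  fixes P :: "'w measure" and k :: nat
    and N :: "nat \<Rightarrow> real \<Rightarrow> 'w \<Rightarrow> nat"
    and M :: "real \<Rightarrow> 'w \<Rightarrow> nat \<Rightarrow> real"
    and Q :: "(nat \<Rightarrow> real) measure"
  assumes "k \<ge> 3"
    and "stationary_meteor_process P k N M Q"
  shows "measure P {\<omega> \<in> space P. M 0 \<omega> 2 = 0} = 1 / 3 \<and>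
    (\<forall>n\<ge>1. k \<ge> n + 4 \<longrightarrow>
      measure P {\<omega> \<in> space P. (\<forall>i\<in>{3..n+2}. M 0 \<omega> i > 0) \<and> M 0 \<omega> 2 = 0 \<and> M 0 \<omega> (n+3) = 0}
        = real n * (real n + 3) * 2 ^ (n + 1) / fact (n + 4)) \<and>
    (\<forall>n\<ge>1. k \<ge> n + 3 \<longrightarrow>
      measure P {\<omega> \<in> space P. \<forall>i\<in>{3..n+2}. M 0 \<omega> i > 0}
        = 2 ^ (n + 1) / fact (n + 2))"
proof -
  interpret stationary_meteor_process P k N M Q by fact
  have sites: "{2<..n + 2} = {3..n + 2}" for n :: nat by auto
  have "prob {\<omega> \<in> space P. M 0 \<omega> 2 = 0} = 1 / 3"
    using prob_vacant_site[of 1] \<open>k \<ge> 3\<close> by (simp add: numeral_2_eq_2)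
  moreover have "prob {\<omega> \<in> space P. (\<forall>i\<in>{3..n + 2}. M 0 \<omega> i > 0) \<and> M 0 \<omega> 2 = 0 \<and> M 0 \<omega> (n + 3) = 0}
      = real n * (real n + 3) * 2 ^ (n + 1) / fact (n + 4)" if "n \<ge> 1" "k \<ge> n + 4" for n
  proof -
    have "1 + 1 = (2 :: nat)" "1 + n + 1 = n + 2" "1 + n + 2 = n + 3" by simp_all
    with prob_run_between_zeros[of 1 n] that show ?thesis by (simp only: sites)
  qed
  moreover have "prob {\<omega> \<in> space P. \<forall>i\<in>{3..n + 2}. M 0 \<omega> i > 0} = 2 ^ (n + 1) / fact (n + 2)"
    if "k \<ge> n + 3" for n
    using prob_positive_run[of 2 n] that by (simp only: sites[symmetric] add.commute[of 2 n])
  ultimately show ?thesis by blast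
qed

end
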